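(* Let $Y$ be a real random variable whose moment generating function $E[e^{tY}]$ exists for $|t|<\rho$ for some $\rho>0$. For every integer $n\ge 0$ and every real $x$, $$d_{n}^{Y}(x)=\sum_{j=0}^{n}\sum_{l=0}^{j}{j \brack l}\binom{n}{j}x^{j}(-1)^{n-j}E[Y^{n-j}].$$
   Context: The probabilistic derangement polynomials of type 2 associated with $Y$, denoted $d_n^Y(x)$, are defined by the generating function (for $t$ near $0$) $$\frac{1}{1-xt}E\big[e^{-Yt}\big]=\sum_{n=0}^{\infty}d_{n}^{Y}(x)\frac{t^{n}}{n!}.$$ The Stirling numbers of the first kind $S_1(n,k)$ are given by $\frac{1}{k!}(\log(1+t))^{k}=\sum_{n=k}^{\infty}S_{1}(n,k)\frac{t^{n}}{n!}$, and the unsigned Stirling numbers of the first kind are ${n \brack k}=(-1)^{n-k}S_{1}(n,k)$ for $n\ge k\ge 0$. Convention: $x^0=1$. *)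

theory Defs
  imports "HOL-Probability.Probability" "HOL-Combinatorics.Stirling"
begin

(* E[exp(-Y t)] is the integral over the underlying space M. The coefficients of a power series
   that converges to a given function near 0 are unique, so the description is definite whenever
   such a series exists; it does as soon as Y has a moment generating function near 0. *)
definition prob_derangement2 :: "'a measure \<Rightarrow> ('a \<Rightarrow> real) \<Rightarrow> nat \<Rightarrow> real \<Rightarrow> real" where
  "prob_derangement2 M Y n x =
     (THE d :: nat \<Rightarrow> real. \<forall>\<^sub>F t in nhds 0.
        (\<lambda>n. d n * (t ^ n / fact n)) sums
          (1 / (1 - x * t) * (\<integral>\<omega>. exp (- Y \<omega> * t) \<partial>M))) n"

(* The library function stirling is given by its recurrence; the two lemmas below show
   that (-1) ^ (n - k) * stirling n k are the numbers S_1(n, k) defined by the generating function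
   ln (1 + t) ^ k / k!. (For n < k the term vanishes, as stirling n k = 0.) *)
lemma fps_ln_power_stirling:
  "fps_const (1 / fact k) * fps_ln (1 :: real) ^ k =
     Abs_fps (\<lambda>n. (-1) ^ (n - k) * real (stirling n k) / fact n)"
proof -
  define g :: "nat \<Rightarrow> real fps"
    where "g k = Abs_fps (\<lambda>n. (-1) ^ (n + k) * real (stirling n k) / fact n)" for k
  have "g k = fps_const (1 / fact k) * fps_ln 1 ^ k"
  proof (induction k)
    case 0
    show ?case
    proof (rule fps_ext)
      fix n show "fps_nth (g 0) n = fps_nth (fps_const (1 / fact 0) * fps_ln 1 ^ 0) n"
        by (cases n) (simp_all add: g_def)
    qed
  next
    case (Suc k)
    have "(1 + fps_X) * fps_deriv (g (Suc k)) = g k"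
    proof (rule fps_ext)
      fix n
      show "fps_nth ((1 + fps_X) * fps_deriv (g (Suc k))) n = fps_nth (g k) n"
      proof -
        have "fps_nth ((1 + fps_X) * fps_deriv (g (Suc k))) n =
            real (Suc n) * fps_nth (g (Suc k)) (Suc n) + real n * fps_nth (g (Suc k)) n"
          by (cases n) (simp_all add: distrib_right)
        also have "real (Suc n) * fps_nth (g (Suc k)) (Suc n) =
            (-1) ^ (n + k) * real (stirling (Suc n) (Suc k)) / fact n"
          by (simp add: g_def del: stirling.simps of_nat_Suc)
        also have "\<dots> + real n * fps_nth (g (Suc k)) n = fps_nth (g k) n"
          by (simp add: g_def field_simps)
        finally show ?thesis .
      qed
    qed
    moreover have "inverse (1 + fps_X) * (1 + fps_X :: real fps) = 1"
      by (intro inverse_mult_eq_1) simp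
    ultimately have "fps_deriv (g (Suc k)) = inverse (1 + fps_X) * g k"
      by (metis mult.assoc mult_1)
    also have "\<dots> = fps_deriv (fps_const (1 / fact (Suc k)) * fps_ln 1 ^ Suc k)"
    proof -
      have "fps_const (1 / fact (Suc k)) * of_nat (Suc k) = fps_const (1 / fact k :: real)"
        unfolding fps_of_nat[symmetric] fps_const_mult
        by (simp add: divide_simps)
      then show ?thesis
        unfolding Suc fps_deriv_mult fps_deriv_const fps_deriv_power fps_ln_deriv
        by (simp add: fps_of_nat algebra_simps del: fact_Suc of_nat_Suc)
    qed
    finally show ?case
      by (subst (asm) fps_deriv_eq_iff) (simp add: g_def)
  qed
  moreover have "g k = Abs_fps (\<lambda>n. (-1) ^ (n - k) * real (stirling n k) / fact n)"
  proof (rule fps_ext)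
    fix n
    show "fps_nth (g k) n = fps_nth (Abs_fps (\<lambda>n. (-1) ^ (n - k) * real (stirling n k) / fact n)) n"
      by (cases "n < k") (simp_all add: g_def uminus_power_if)
  qed
  ultimately show ?thesis by simp
qed

lemma ln_power_sums_stirling:
  assumes "\<bar>t\<bar> < 1"
  shows "(\<lambda>n. (-1) ^ (n - k) * real (stirling n k) * (t ^ n / fact n)) sums
           (ln (1 + t) ^ k / fact k)"
proof -
  have r: "ereal (norm t) < fps_conv_radius (fps_ln (1 :: real))"
    using assms by (simp add: one_ereal_def)
  also have "\<dots> \<le> fps_conv_radius (fps_ln (1 :: real) ^ k)"
    by (rule fps_conv_radius_power)
  finally have rk: "ereal (norm t) < fps_conv_radius (fps_ln (1 :: real) ^ k)" .
  have "(\<lambda>n. fps_nth (fps_ln 1) n * t ^ n) = (\<lambda>n. - ((- t) ^ n) / real n)"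
  proof
    fix n show "fps_nth (fps_ln 1) n * t ^ n = - ((- t) ^ n) / real n"
      by (cases n) (simp_all add: fps_ln_nth power_minus[of t] del: of_nat_Suc)
  qed
  then have "eval_fps (fps_ln 1) t = ln (1 + t)"
    using ln_series'[OF assms] by (simp add: eval_fps_def sums_iff)
  then have "(\<lambda>n. fps_nth (fps_ln 1 ^ k) n * t ^ n) sums (ln (1 + t) ^ k)"
    using sums_eval_fps[OF rk] eval_fps_power[OF r] by simp
  then have "(\<lambda>n. 1 / fact k * (fps_nth (fps_ln 1 ^ k) n * t ^ n)) sums
               (1 / fact k * ln (1 + t) ^ k)"
    by (rule sums_mult)
  moreover have "1 / fact k * (fps_nth (fps_ln 1 ^ k) n * t ^ n) =
      (-1) ^ (n - k) * real (stirling n k) * (t ^ n / fact n)" for n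
    using arg_cong[OF fps_ln_power_stirling[of k], of "\<lambda>F. fps_nth F n"]
    by (simp add: field_simps)
  ultimately show ?thesis by simp
qed

end

theory Submission
  imports Defs "HOL-Complex_Analysis.Cauchy_Integral_Formula"
begin

text \<open>
  Both factors of the generating function are exponential generating functions: \<open>1 / (1 - x t)\<close>
  is the one of \<open>j! x^j\<close>, and \<open>E[exp (- Y t)]\<close> is the one of the alternating moments
  \<open>(-1)^m E[Y^m]\<close>. Multiplying them gives the binomial convolution
  \<open>\<Sum>j\<le>n. (n choose j) j! x^j (-1)^(n-j) E[Y^(n-j)]\<close>. The Stirling numbers enter only through
  their row sums: \<open>\<Sum>l\<le>j. stirling j l = j!\<close>, the number of permutations of \<open>j\<close> points sorted by
  number of cycles.

  The analytic content is the expansion of \<open>E[exp (- Y t)]\<close>. The partial sums of the exponential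
  series of \<open>u\<close> are bounded by \<open>exp \<bar>u\<bar> \<le> exp u + exp (- u)\<close>, so the two-sided moment generating
  function supplies an integrable majorant, which gives existence of all moments and, by dominated
  convergence, the interchange of sum and expectation. Finally, coefficients of a power series are
  determined by its sum near 0, so the convolution is the sequence singled out by the
  definite description in the definition of the polynomials.
\<close>

lemma exp_partial_sum_le:
  fixes u :: real
  shows "(\<Sum>k<n. \<bar>u\<bar> ^ k / fact k) \<le> exp u + exp (- u)"
proof -
  have s: "(\<lambda>k. \<bar>u\<bar> ^ k / fact k) sums exp \<bar>u\<bar>"
    using exp_converges[of "\<bar>u\<bar>"] by (simp add: field_simps)
  have "(\<Sum>k<n. \<bar>u\<bar> ^ k / fact k) \<le> exp \<bar>u\<bar>"
    using sum_le_suminf[OF sums_summable[OF s], of "{..<n}"] sums_unique[OF s] by simp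
  also have "\<dots> \<le> exp u + exp (- u)"
    by (simp add: abs_if)
  finally show ?thesis .
qed

text \<open>
  A single term \<open>\<bar>s Y\<bar>^k / k!\<close> of the exponential series is below its partial sum, hence below
  \<open>exp (s Y) + exp (- s Y)\<close>; multiplying by \<open>k! / s^k\<close> gives the integrable majorant of \<open>\<bar>Y\<bar>^k\<close>.
\<close>

lemma integrable_power_of_mgf:
  fixes Y :: "'a \<Rightarrow> real"
  assumes [measurable]: "Y \<in> borel_measurable M"
    and "s > 0"
    and int: "integrable M (\<lambda>\<omega>. exp (s * Y \<omega>))" "integrable M (\<lambda>\<omega>. exp (- (s * Y \<omega>)))"
  shows "integrable M (\<lambda>\<omega>. Y \<omega> ^ k)"
proof (rule Bochner_Integration.integrable_bound)
  show "integrable M (\<lambda>\<omega>. fact k / s ^ k * (exp (s * Y \<omega>) + exp (- (s * Y \<omega>))))"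
    using int by simp
  have "\<bar>Y \<omega>\<bar> ^ k \<le> fact k / s ^ k * (exp (s * Y \<omega>) + exp (- (s * Y \<omega>)))" for \<omega>
  proof -
    have "\<bar>s * Y \<omega>\<bar> ^ k / fact k \<le> (\<Sum>i<Suc k. \<bar>s * Y \<omega>\<bar> ^ i / fact i)"
      by (simp add: sum_nonneg)
    also have "\<dots> \<le> exp (s * Y \<omega>) + exp (- (s * Y \<omega>))"
      by (rule exp_partial_sum_le)
    finally show ?thesis
      using \<open>s > 0\<close> by (simp add: abs_mult power_mult_distrib field_simps)
  qed
  then show "AE \<omega> in M. norm (Y \<omega> ^ k) \<le>
      norm (fact k / s ^ k * (exp (s * Y \<omega>) + exp (- (s * Y \<omega>))))"
    by (intro AE_I2) (metis norm_power real_norm_def order.trans abs_ge_self)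
qed measurable

text \<open>
  Dominated convergence applied to the partial sums of the exponential series, with the majorant
  \<open>exp (t Y) + exp (- t Y)\<close>.
\<close>

lemma mgf_sums_moments:
  fixes Y :: "'a \<Rightarrow> real"
  assumes [measurable]: "Y \<in> borel_measurable M"
    and moments: "\<And>k. integrable M (\<lambda>\<omega>. Y \<omega> ^ k)"
    and int: "integrable M (\<lambda>\<omega>. exp (t * Y \<omega>))" "integrable M (\<lambda>\<omega>. exp (- (t * Y \<omega>)))"
  shows "(\<lambda>k. (\<integral>\<omega>. Y \<omega> ^ k \<partial>M) / fact k * t ^ k) sums (\<integral>\<omega>. exp (t * Y \<omega>) \<partial>M)"
proof -
  let ?S = "\<lambda>n \<omega>. \<Sum>k<n. (t * Y \<omega>) ^ k / fact k"
  have "(\<lambda>n. \<integral>\<omega>. ?S n \<omega> \<partial>M) \<longlonglongrightarrow> (\<integral>\<omega>. exp (t * Y \<omega>) \<partial>M)"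
  proof (rule integral_dominated_convergence)
    show "integrable M (\<lambda>\<omega>. exp (t * Y \<omega>) + exp (- (t * Y \<omega>)))"
      using int by simp
    have "(\<lambda>n. ?S n \<omega>) \<longlonglongrightarrow> exp (t * Y \<omega>)" for \<omega>
      using exp_converges[of "t * Y \<omega>"] by (simp add: sums_def field_simps)
    then show "AE \<omega> in M. (\<lambda>n. ?S n \<omega>) \<longlonglongrightarrow> exp (t * Y \<omega>)"
      by simp
    have "norm (?S n \<omega>) \<le> exp (t * Y \<omega>) + exp (- (t * Y \<omega>))" for n \<omega>
    proof -
      have "norm (?S n \<omega>) \<le> (\<Sum>k<n. \<bar>t * Y \<omega>\<bar> ^ k / fact k)"
        by (rule sum_norm_le) (simp add: power_abs)
      then show ?thesis
        using exp_partial_sum_le[where u = "t * Y \<omega>" and n = n] by linarith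
    qed
    then show "AE \<omega> in M. norm (?S n \<omega>) \<le> exp (t * Y \<omega>) + exp (- (t * Y \<omega>))" for n
      by simp
  qed measurable
  moreover have "(\<integral>\<omega>. ?S n \<omega> \<partial>M) = (\<Sum>k<n. (\<integral>\<omega>. Y \<omega> ^ k \<partial>M) / fact k * t ^ k)" for n
    using moments by (simp add: power_mult_distrib field_simps)
  ultimately show ?thesis
    by (simp add: sums_def)
qed

lemma power_series_coeffs_unique:
  fixes a b :: "nat \<Rightarrow> real"
  assumes "\<forall>\<^sub>F t in nhds 0. (\<lambda>n. a n * t ^ n) sums f t"
    and "\<forall>\<^sub>F t in nhds 0. (\<lambda>n. b n * t ^ n) sums f t"
  shows "a = b"
proof -
  \<comment> \<open>A power series with a nonzero coefficient has no zeros near 0 apart from 0 itself, so the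
    difference of the two series, which sums to 0 everywhere near 0, has only zero coefficients.\<close>
  have "\<forall>\<^sub>F t in nhds 0. (\<lambda>n. (a n - b n) * t ^ n) sums 0"
    using assms by eventually_elim (auto dest: sums_diff simp: left_diff_distrib)
  then obtain e where "e > 0" and e: "\<And>t. dist t 0 < e \<Longrightarrow> (\<lambda>n. (a n - b n) * t ^ n) sums 0"
    unfolding eventually_nhds_metric by blast
  have "a m - b m = 0" for m
  proof (rule ccontr)
    assume "a m - b m \<noteq> 0"
    moreover from this have "m > 0"
      using e[of 0] \<open>e > 0\<close> powser_sums_zero_iff[of "\<lambda>n. a n - b n" 0] by (cases m) auto
    ultimately obtain s where "s > 0" and
      s: "\<And>z::real. z \<in> cball 0 s - {0} \<Longrightarrow> (\<lambda>_. 0 :: real) z \<noteq> 0"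
      using powser_0_nonzero[where r = e and \<xi> = 0 and a = "\<lambda>n. a n - b n"
          and f = "\<lambda>_. 0" and m = m] e \<open>e > 0\<close>
      by (auto simp: dist_real_def)
    then show False
      using s[of s] by simp
  qed
  then show ?thesis
    by (simp add: fun_eq_iff)
qed

lemma prob_derangement2_eqI:
  assumes "\<forall>\<^sub>F t in nhds 0. (\<lambda>n. d n * (t ^ n / fact n)) sums
             (1 / (1 - x * t) * (\<integral>\<omega>. exp (- Y \<omega> * t) \<partial>M))"
  shows "prob_derangement2 M Y n x = d n"
proof -
  have "d' = d" if "\<forall>\<^sub>F t in nhds 0. (\<lambda>n. d' n * (t ^ n / fact n)) sums
             (1 / (1 - x * t) * (\<integral>\<omega>. exp (- Y \<omega> * t) \<partial>M))" for d'
  proof -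
    have "(\<lambda>n. d' n / fact n) = (\<lambda>n. d n / fact n)"
      using that assms by (intro power_series_coeffs_unique) simp_all
    then show ?thesis
      by (simp add: fun_eq_iff)
  qed
  then show ?thesis
    unfolding prob_derangement2_def using assms by (intro fun_cong[OF the_equality]) blast+
qed

text \<open>
  This is the Cauchy product: \<open>j! x^j\<close> are the exponential coefficients of the geometric series,
  and moving from ordinary to exponential coefficients produces the binomial factor
  \<open>n! / (j! (n - j)!)\<close>. Absolute convergence of both series justifies the rearrangement.
\<close>

lemma geometric_times_egf_sums:
  fixes x t :: real and m :: "nat \<Rightarrow> real"
  assumes "\<bar>x * t\<bar> < 1"
    and "summable (\<lambda>k. norm (m k / fact k * t ^ k))"
  shows "(\<lambda>n. (\<Sum>j = 0..n. fact j * real (n choose j) * x ^ j * m (n - j)) * (t ^ n / fact n)) sums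
           (1 / (1 - x * t) * (\<Sum>k. m k / fact k * t ^ k))"
proof -
  have "summable (\<lambda>j. norm ((x * t) ^ j))"
    using assms(1) by (simp add: norm_power del: real_norm_def) (simp add: summable_geometric)
  then have "(\<lambda>n. \<Sum>j\<le>n. (x * t) ^ j * (m (n - j) / fact (n - j) * t ^ (n - j))) sums
          ((\<Sum>j. (x * t) ^ j) * (\<Sum>k. m k / fact k * t ^ k))"
    using assms(2) by (intro Cauchy_product_sums)
  moreover have "(\<Sum>j. (x * t) ^ j) = 1 / (1 - x * t)"
    using assms(1) by (intro suminf_geometric) simp
  moreover have "(\<Sum>j\<le>n. (x * t) ^ j * (m (n - j) / fact (n - j) * t ^ (n - j))) =
      (\<Sum>j = 0..n. fact j * real (n choose j) * x ^ j * m (n - j)) * (t ^ n / fact n)" for n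
  proof -
    have "(x * t) ^ j * (m (n - j) / fact (n - j) * t ^ (n - j)) =
        fact j * real (n choose j) * x ^ j * m (n - j) * (t ^ n / fact n)" if "j \<le> n" for j
    proof -
      have "t ^ n = t ^ j * t ^ (n - j)"
        using that by (simp flip: power_add)
      then show ?thesis
        using that by (simp add: binomial_fact power_mult_distrib field_simps)
    qed
    then show ?thesis
      unfolding sum_distrib_right atMost_atLeast0 by (intro sum.cong) auto
  qed
  ultimately show ?thesis
    by simp
qed

theorem theorem2p11:
  fixes M :: "'a measure" and Y :: "'a \<Rightarrow> real" and \<rho> x :: real and n :: nat
  assumes "prob_space M"
    and "Y \<in> borel_measurable M"
    and "\<rho> > 0"
    and "\<And>t :: real. \<bar>t\<bar> < \<rho> \<Longrightarrow> integrable M (\<lambda>\<omega>. exp (t * Y \<omega>))"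
  shows "prob_derangement2 M Y n x =
    (\<Sum>j = 0..n. \<Sum>l = 0..j.
       real (stirling j l) * real (n choose j) * x ^ j * (-1) ^ (n - j) *
       (\<integral>\<omega>. Y \<omega> ^ (n - j) \<partial>M))"
proof -
  define \<mu> where "\<mu> k = (\<integral>\<omega>. Y \<omega> ^ k \<partial>M)" for k
  have int: "integrable M (\<lambda>\<omega>. exp (t * Y \<omega>))" "integrable M (\<lambda>\<omega>. exp (- (t * Y \<omega>)))"
    if "\<bar>t\<bar> < \<rho>" for t
    using assms(4)[of t] assms(4)[of "- t"] that by simp_all
  have moments: "integrable M (\<lambda>\<omega>. Y \<omega> ^ k)" for k
    using integrable_power_of_mgf[OF assms(2), of "\<rho> / 2"] int[of "\<rho> / 2"] \<open>\<rho> > 0\<close> by simp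
  have mgf: "(\<lambda>k. \<mu> k / fact k * t ^ k) sums (\<integral>\<omega>. exp (t * Y \<omega>) \<partial>M)" if "\<bar>t\<bar> < \<rho>" for t
    unfolding \<mu>_def using mgf_sums_moments[OF assms(2) moments int[OF that]] .

  have gen_fun: "(\<lambda>n. (\<Sum>j = 0..n. fact j * real (n choose j) * x ^ j * ((-1) ^ (n - j) * \<mu> (n - j)))
          * (t ^ n / fact n)) sums (1 / (1 - x * t) * (\<integral>\<omega>. exp (- Y \<omega> * t) \<partial>M))"
    if "\<bar>t\<bar> < \<rho>" "\<bar>x * t\<bar> < 1" for t
  proof -
    have term_eq: "(-1) ^ k * \<mu> k / fact k * t ^ k = \<mu> k / fact k * (- t) ^ k" for k
      by (simp add: power_minus[of t])
    \<comment> \<open>Convergence at the midpoint of \<open>\<bar>t\<bar>\<close> and \<open>\<rho>\<close> yields absolute convergence at \<open>- t\<close>.\<close>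
    have "summable (\<lambda>k. norm (\<mu> k / fact k * (- t) ^ k))"
      using that by (intro powser_insidea[where x = "(\<bar>t\<bar> + \<rho>) / 2"] sums_summable[OF mgf]) auto
    then have abs: "summable (\<lambda>k. norm ((-1) ^ k * \<mu> k / fact k * t ^ k))"
      unfolding term_eq .
    have "(\<Sum>k. (-1) ^ k * \<mu> k / fact k * t ^ k) = (\<integral>\<omega>. exp (- Y \<omega> * t) \<partial>M)"
      unfolding term_eq using mgf[of "- t"] that by (simp add: sums_iff mult.commute)
    with geometric_times_egf_sums[OF that(2), of "\<lambda>k. (-1) ^ k * \<mu> k", OF abs]
    show ?thesis by simp
  qed

  have "((\<lambda>t. \<bar>x * t\<bar>) \<longlongrightarrow> \<bar>x * 0\<bar>) (nhds 0)"
    by (intro tendsto_intros filterlim_ident)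
  then have "\<forall>\<^sub>F t in nhds 0. \<bar>x * t\<bar> < 1"
    by (rule order_tendstoD) simp
  moreover have "\<forall>\<^sub>F t in nhds 0. \<bar>t\<bar> < \<rho>"
    using \<open>\<rho> > 0\<close> by (auto simp: eventually_nhds_metric dist_real_def)
  ultimately have "\<forall>\<^sub>F t in nhds 0.
      (\<lambda>n. (\<Sum>j = 0..n. fact j * real (n choose j) * x ^ j * ((-1) ^ (n - j) * \<mu> (n - j)))
        * (t ^ n / fact n)) sums (1 / (1 - x * t) * (\<integral>\<omega>. exp (- Y \<omega> * t) \<partial>M))"
    by eventually_elim (rule gen_fun)
  then have "prob_derangement2 M Y n x =
      (\<Sum>j = 0..n. fact j * real (n choose j) * x ^ j * ((-1) ^ (n - j) * \<mu> (n - j)))"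
    by (rule prob_derangement2_eqI)
  also have "\<dots> = (\<Sum>j = 0..n. \<Sum>l = 0..j.
       real (stirling j l) * real (n choose j) * x ^ j * (-1) ^ (n - j) * \<mu> (n - j))"
  proof (rule sum.cong)
    fix j
    have "(fact j :: real) = (\<Sum>l = 0..j. real (stirling j l))"
      using arg_cong[OF sum_stirling[of j], of real] by (simp add: atMost_atLeast0)
    then show "fact j * real (n choose j) * x ^ j * ((-1) ^ (n - j) * \<mu> (n - j)) =
        (\<Sum>l = 0..j. real (stirling j l) * real (n choose j) * x ^ j * (-1) ^ (n - j) * \<mu> (n - j))"
      by (simp only: sum_distrib_right mult.assoc)
  qed simp
  finally show ?thesis
    unfolding \<mu>_def .
qed

end
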